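(* Let $\alpha\in\mathbb{C}\setminus\{-1,-2,-3,\ldots\}$. Consider the bilinear functional on $\mathbb{C}[x]$ $$\mathcal{B}_\alpha(f,g)=\mathrm{f.p.}\!\int_0^\infty x^{\alpha}e^{-x}f(x)g(x)\,dx ,$$ and the Laguerre polynomials $L_n^{(\alpha)}$ ($n=0,1,2,\ldots$) normalized by $$L_n^{(\alpha)}(x)=w(x)^{-1}\frac{d^n}{dx^n}\left[x^n w(x)\right],\qquad w(x)=x^\alpha e^{-x}.$$ Then for all integers $n,k\ge 0$ $$\mathcal{B}_\alpha\left(L_n^{(\alpha)},L_k^{(\alpha)}\right)=0\ \text{ for } k\neq n,\qquad \mathcal{B}_\alpha\left(L_n^{(\alpha)},L_n^{(\alpha)}\right)=n!\,\Gamma(\alpha+n+1).$$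
   Context: Hadamard finite part on the half line: let $\alpha\in\mathbb{C}\setminus\{-1,-2,\ldots\}$, let $F$ be analytic on $[0,+\infty)$ with Taylor series $F(t)=\sum_{m\ge0}F_m t^m$ at $0$, and suppose $t^\alpha F(t)$ is integrable near $+\infty$. Then $$\mathrm{f.p.}\!\int_0^\infty t^\alpha F(t)\,dt:=\sum_{m=0}^\infty \frac{F_m}{m+\alpha+1}\,\xi^{m+\alpha+1}+\int_\xi^\infty t^\alpha F(t)\,dt,$$ where $\xi>0$ is any number smaller than the radius of convergence of the Taylor series (the value does not depend on $\xi$) and $t^\alpha=e^{\alpha\ln t}$ for $t>0$. When $\Re\alpha>-1$ this is the ordinary integral. In $\mathcal{B}_\alpha(f,g)$ one takes $F(x)=e^{-x}f(x)g(x)$. The functions $L_n^{(\alpha)}$ defined by the formula in the claim are polynomials of degree $n$ with leading coefficient $(-1)^n$. *)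

theory Defs
  imports "HOL-Complex_Analysis.Complex_Analysis"
begin

(* "F is analytic on [0,infinity)" means that F, as a function of a complex variable, is
   analytic in a neighbourhood of the half line; F_m is then the m-th coefficient of
   fps_expansion F 0.  For real t > 0, "complex_of_real t powr \<alpha>" is exp (\<alpha> * ln t).
   The last clause asks for the same value I for every admissible \<xi>; an admissible \<xi> exists
   because analyticity at 0 makes the radius of convergence positive. *)
definition has_fp_integral :: "complex \<Rightarrow> (complex \<Rightarrow> complex) \<Rightarrow> complex \<Rightarrow> bool" where
  "has_fp_integral \<alpha> F I \<longleftrightarrow>
     \<alpha> \<notin> {- of_nat m | m :: nat. m \<ge> 1} \<and>
     F analytic_on complex_of_real ` {0..} \<and>
     (\<exists>a>0. set_integrable lborel {a..} (\<lambda>t. complex_of_real t powr \<alpha> * F (complex_of_real t))) \<and>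
     (\<forall>\<xi>::real. 0 < \<xi> \<and> ereal \<xi> < fps_conv_radius (fps_expansion F 0) \<longrightarrow>
        I = (\<Sum>m. fps_nth (fps_expansion F 0) m / (of_nat m + \<alpha> + 1)
                   * complex_of_real \<xi> powr (of_nat m + \<alpha> + 1))
            + (LINT t:{\<xi>..}|lborel. complex_of_real t powr \<alpha> * F (complex_of_real t)))"

definition fp_integral :: "complex \<Rightarrow> (complex \<Rightarrow> complex) \<Rightarrow> complex" where
  "fp_integral \<alpha> F = (THE I. has_fp_integral \<alpha> F I)"

definition laguerre_form :: "complex \<Rightarrow> complex poly \<Rightarrow> complex poly \<Rightarrow> complex" where
  "laguerre_form \<alpha> f g = fp_integral \<alpha> (\<lambda>x. exp (- x) * poly f x * poly g x)"

definition laguerre_weight :: "complex \<Rightarrow> real \<Rightarrow> complex" where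
  "laguerre_weight \<alpha> x = complex_of_real x powr \<alpha> * exp (- complex_of_real x)"

(* The polynomial given by the Rodrigues formula on the positive half line, where the weight
   is defined and nonzero.  The factor 1 / n! of the usual normalization is absent. *)
definition laguerre :: "complex \<Rightarrow> nat \<Rightarrow> complex poly" where
  "laguerre \<alpha> n = (THE p. \<forall>x::real. x > 0 \<longrightarrow>
     poly p (complex_of_real x) =
       inverse (laguerre_weight \<alpha> x) *
       ((\<lambda>f y. vector_derivative f (at y)) ^^ n)
         (\<lambda>y. complex_of_real y ^ n * laguerre_weight \<alpha> y) x)"

end

theory Submission
  imports Defs
begin

text \<open>
  The finite part of \<open>x\<^sup>i\<close> against the weight \<open>x\<^sup>\<alpha> exp (-x)\<close> is \<open>\<Gamma>(\<alpha> + i + 1)\<close>: where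
  \<open>Re \<alpha> + i > -1\<close> this is Euler's integral split at \<open>\<xi>\<close>, and elsewhere both the Taylor part
  and the tail satisfy the recurrence in \<open>\<alpha>\<close> obtained from integration by parts, with boundary
  terms at \<open>\<xi>\<close> that cancel. The form is thus a purely algebraic functional of the product \<open>f g\<close>,
  for which integration by parts is the functional equation of the Gamma function. Moving the
  \<open>n\<close> derivatives of the Rodrigues formula onto the other factor gives zero if its degree is below
  \<open>n\<close>, and if the degree is \<open>n\<close> only its leading coefficient counts.
\<close>

section \<open>The Taylor part: a power series for the lower incomplete Gamma function\<close>

definition gamma_coeff :: "complex \<Rightarrow> nat \<Rightarrow> complex" where
  "gamma_coeff s m = (-1) ^ m / (fact m * (of_nat m + s))"

text \<open>For \<open>s\<close> outside the nonpositive integers,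
  \<open>z powr s * gamma_series s z\<close> is the lower incomplete Gamma function, obtained by
  integrating \<open>t powr (s - 1) * exp (-t)\<close> term by term. Splitting off the power leaves
  a series that converges everywhere.\<close>

definition gamma_series :: "complex \<Rightarrow> complex \<Rightarrow> complex" where
  "gamma_series s z = (\<Sum>m. gamma_coeff s m * z ^ m)"

lemma of_nat_add_nonzero:
  assumes "s \<notin> \<int>\<^sub>\<le>\<^sub>0"
  shows "of_nat m + s \<noteq> (0::complex)"
proof
  assume "of_nat m + s = 0"
  then have "s = of_int (- int m)" 
    using eq_neg_iff_add_eq_0[of s "of_nat m"] by (simp only: add.commute of_int_minus of_int_of_nat_eq)
  moreover have "of_int (- int m) \<in> (\<int>\<^sub>\<le>\<^sub>0 :: complex set)" by (rule nonpos_Ints_of_int) simp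
  ultimately have "s \<in> \<int>\<^sub>\<le>\<^sub>0" by (rule ssubst)
  with assms show False by contradiction
qed

lemma gamma_coeff_mult:
  assumes "s \<notin> \<int>\<^sub>\<le>\<^sub>0"
  shows "(of_nat m + s) * gamma_coeff s m = (-1) ^ m / fact m"
  using of_nat_add_nonzero[OF assms, of m] by (simp add: gamma_coeff_def)

lemma exp_minus_sums: "(\<lambda>m. (-1) ^ m / fact m * z ^ m) sums exp (- z :: complex)"
  using exp_converges[of "- z"] by (simp add: scaleR_conv_of_real field_simps power_minus[of z])

lemma summable_gamma_series:
  shows "summable (\<lambda>m. gamma_coeff s m * z ^ m)"
proof (rule summable_comparison_test_ev)
  \<comment> \<open>From this point on the denominators \<open>of_nat m + s\<close> have modulus at
    least 1, so the exponential series dominates.\<close>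
  have ev: "eventually (\<lambda>m. real m \<ge> norm s + 1) sequentially"
    by real_asymp
  show "eventually (\<lambda>m. norm (gamma_coeff s m * z ^ m) \<le> norm z ^ m / fact m) sequentially"
    using ev
  proof eventually_elim
    case (elim m)
    have "norm (of_nat m + s) \<ge> norm (of_nat m :: complex) - norm s"
      by (rule norm_diff_ineq)
    with elim have "1 \<le> norm (of_nat m + s)" by simp
    then have "norm z ^ m / (fact m * norm (of_nat m + s)) \<le> norm z ^ m / (fact m * 1)"
      by (intro divide_left_mono mult_left_mono mult_pos_pos) auto
    then show ?case
      by (simp add: gamma_coeff_def norm_mult norm_divide norm_power)
  qed
  show "summable (\<lambda>m. norm z ^ m / fact m)"
    using summable_exp[of "norm z"] by (simp add: field_simps)
qed

lemma gamma_series_sums: "(\<lambda>m. gamma_coeff s m * z ^ m) sums gamma_series s z"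
  unfolding gamma_series_def using summable_gamma_series by (rule summable_sums)

text \<open>Write \<open>s = (m + 1 + s) - (m + 1)\<close>: the first summand cancels the
  denominator, the second cancels a factor of the factorial.\<close>

lemma gamma_coeff_Suc:
  assumes "s \<notin> \<int>\<^sub>\<le>\<^sub>0"
  shows "s * gamma_coeff s (Suc m) = gamma_coeff (s + 1) m + (-1) ^ Suc m / fact (Suc m)"
proof -
  have [simp]: "1 + (s + of_nat m) \<noteq> 0" using of_nat_add_nonzero[OF assms, of "Suc m"] by (simp add: add_ac)
  have [simp]: "1 + of_nat m \<noteq> (0::complex)" 
    by (metis of_nat_Suc of_nat_neq_0)
  show ?thesis 
    by (simp add: gamma_coeff_def add_ac divide_simps) (simp add: algebra_simps)
qed

text \<open>The Taylor half of the recurrence in \<open>s\<close>. After multiplication by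
  \<open>z powr s\<close>, the term \<open>exp (- z)\<close> becomes the boundary term of an
  integration by parts.\<close>

lemma gamma_series_rec:
  assumes "s \<notin> \<int>\<^sub>\<le>\<^sub>0"
  shows "s * gamma_series s z = z * gamma_series (s + 1) z + exp (- z)"
proof -
  \<comment> \<open>The series of \<open>z * gamma_series (s + 1) z\<close> in powers of
    \<open>z\<close>: the factor \<open>z\<close> shifts the index by one and leaves no constant
    term.\<close>
  let ?u = "\<lambda>m. case m of 0 \<Rightarrow> 0 | Suc k \<Rightarrow> gamma_coeff (s + 1) k * z ^ k * z"
  have "(\<lambda>m. ?u (Suc m)) sums (gamma_series (s + 1) z * z)"
    using sums_mult2[OF gamma_series_sums] by simp
  then have "?u sums (gamma_series (s + 1) z * z)"
    by (subst (asm) sums_Suc_iff) simp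
  from sums_add[OF this exp_minus_sums[of z]]
  have "(\<lambda>m. ?u m + (-1) ^ m / fact m * z ^ m) sums (gamma_series (s + 1) z * z + exp (- z))" .
  moreover have "?u m + (-1) ^ m / fact m * z ^ m = s * (gamma_coeff s m * z ^ m)" for m
  proof (cases m)
    case 0
    then show ?thesis using gamma_coeff_mult[OF assms, of 0] by simp
  next
    case (Suc k)
    have "s * (gamma_coeff s m * z ^ m) = (s * gamma_coeff s (Suc k)) * z ^ Suc k"
      using Suc by simp
    also have "\<dots> = ?u m + (-1) ^ m / fact m * z ^ m"
      unfolding gamma_coeff_Suc[OF assms] using Suc by (simp add: algebra_simps)
    finally show ?thesis ..
  qed
  ultimately show ?thesis
    using sums_unique2[OF _ sums_mult[OF gamma_series_sums[of s z], of s]] by (simp add: mult.commute)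
qed

text \<open>The operator \<open>z d/dz + s\<close> multiplies the m-th coefficient by
  \<open>m + s\<close>, which clears the denominator. Multiplied by \<open>z powr (s - 1)\<close>,
  the equation exhibits an antiderivative of Euler's integrand.\<close>

lemma gamma_series_deriv:
  obtains d where "(gamma_series s has_field_derivative d) (at z)"
    and "s \<notin> \<int>\<^sub>\<le>\<^sub>0 \<Longrightarrow> z * d + s * gamma_series s z = exp (- z)"
proof
  let ?d = "\<Sum>m. diffs (gamma_coeff s) m * z ^ m"
  show "(gamma_series s has_field_derivative ?d) (at z)"
    unfolding gamma_series_def[abs_def]
    by (rule termdiffs_strong_converges_everywhere) (rule summable_gamma_series)
  assume s: "s \<notin> \<int>\<^sub>\<le>\<^sub>0"
  have "summable (\<lambda>m. diffs (gamma_coeff s) m * z ^ m)"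
    by (rule termdiff_converges_all) (rule summable_gamma_series)
  then have "(\<lambda>m. of_nat m * gamma_coeff s m * z ^ (m - Suc 0)) sums ?d"
    by (rule diffs_equiv)
  from sums_add[OF sums_mult[OF this, of z] sums_mult[OF gamma_series_sums[of s z], of s]]
  have "(\<lambda>m. z * (of_nat m * gamma_coeff s m * z ^ (m - Suc 0)) + s * (gamma_coeff s m * z ^ m))
     sums (z * ?d + s * gamma_series s z)" .
  moreover have "z * (of_nat m * gamma_coeff s m * z ^ (m - Suc 0)) + s * (gamma_coeff s m * z ^ m)
    = (-1) ^ m / fact m * z ^ m" for m
    unfolding gamma_coeff_mult[OF s, symmetric]
    by (cases m) (simp_all add: algebra_simps)
  ultimately show "z * ?d + s * gamma_series s z = exp (- z)"
    using sums_unique2[OF _ exp_minus_sums] by simp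
qed

section \<open>The tail: the upper incomplete Gamma function\<close>

lemma set_integrable_powr_exp:
  assumes "0 < \<xi>"
  shows "set_integrable lborel {\<xi>..} (\<lambda>t. complex_of_real t powr a * exp (- complex_of_real t))"
proof -
  \<comment> \<open>The shift by \<open>N\<close> brings the exponent into the range of Euler's
    integral. Since \<open>(t / \<xi>) ^ N\<close> is at least 1 for \<open>t \<ge> \<xi>\<close>,
    the shifted integrand divided by \<open>\<xi> ^ N\<close> is a majorant.\<close>
  define N where "N = nat \<lceil>max 0 (- Re a)\<rceil>"
  let ?z = "a + of_nat N + 1"
  have N: "Re ?z > 0" unfolding N_def by (simp, linarith)
  have "(\<lambda>t. complex_of_real t powr (?z - 1) / of_real (exp t)) absolutely_integrable_on {\<xi>..}"
    by (rule set_integrable_subset[OF absolutely_integrable_Gamma_integral'[OF N]])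
       (use assms in auto)
  then have bound: "set_integrable lebesgue {\<xi>..} (\<lambda>t. complex_of_real (1 / \<xi> ^ N) * (complex_of_real t powr (?z - 1) / of_real (exp t)))"
    by (rule set_integrable_mult_right[rotated])
  have m: "set_borel_measurable lborel {\<xi>..} (\<lambda>t. complex_of_real t powr a * exp (- complex_of_real t))"
    using borel_measurable_continuous_on_indicator[of "{\<xi>..}" "\<lambda>t. complex_of_real t powr a * exp (- complex_of_real t)"] assms
    by (auto simp: set_borel_measurable_def intro!: continuous_intros)
  from bound have "set_integrable lebesgue {\<xi>..} (\<lambda>t. complex_of_real t powr a * exp (- complex_of_real t))"
  proof (rule set_integrable_bound)
    show "set_borel_measurable lebesgue {\<xi>..} (\<lambda>t. complex_of_real t powr a * exp (- complex_of_real t))"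
      using m unfolding set_borel_measurable_def by (rule measurable_completion)
    show "AE t in lebesgue. t \<in> {\<xi>..} \<longrightarrow> norm (complex_of_real t powr a * exp (- complex_of_real t))
       \<le> norm (complex_of_real (1 / \<xi> ^ N) * (complex_of_real t powr (?z - 1) / of_real (exp t)))"
    proof (intro AE_I2 impI)
      fix t assume t: "t \<in> {\<xi>..}"
      have e: "norm (complex_of_real t powr (?z - 1)) = t powr Re a * t ^ N"
        using t assms by (subst norm_powr_real_powr) (auto simp: powr_add powr_realpow)
      have "t powr Re a * 1 \<le> t powr Re a * (t ^ N / \<xi> ^ N)"
        using t assms by (intro mult_left_mono) (auto simp: power_mono divide_simps)
      then show "norm (complex_of_real t powr a * exp (- complex_of_real t))
       \<le> norm (complex_of_real (1 / \<xi> ^ N) * (complex_of_real t powr (?z - 1) / of_real (exp t)))"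
        unfolding norm_mult norm_divide e using t assms
        by (subst norm_powr_real_powr) (auto simp: exp_minus divide_simps norm_power norm_divide)
    qed
  qed
  \<comment> \<open>Euler's integral was taken over the completed measure; Borel measurability
    brings integrability back to \<open>lborel\<close>.\<close>
  then show ?thesis
    using m unfolding set_integrable_def set_borel_measurable_def by (subst (asm) integrable_completion) auto
qed

definition upper_gamma :: "complex \<Rightarrow> real \<Rightarrow> complex" where
  "upper_gamma s \<xi> = (LINT t:{\<xi>..}|lborel. complex_of_real t powr (s - 1) * exp (- complex_of_real t))"

lemma has_vector_derivative_powr_of_real:
  assumes "0 < t"
  shows "((\<lambda>t. complex_of_real t powr s) has_vector_derivative s * complex_of_real t powr (s - 1)) (at t)"
  using assms by (auto intro!: has_vector_derivative_real_field derivative_eq_intros)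

lemma tendsto_powr_exp_at_top: "((\<lambda>t. complex_of_real t powr s * exp (- complex_of_real t)) \<longlongrightarrow> 0) at_top"
proof (rule tendsto_norm_zero_cancel)
  have "((\<lambda>t. t powr Re s * exp (- t)) \<longlongrightarrow> 0) at_top"
    by real_asymp
  then show "((\<lambda>t. norm (complex_of_real t powr s * exp (- complex_of_real t))) \<longlongrightarrow> 0) at_top"
    by (rule Lim_transform_eventually)
       (use eventually_gt_at_top[of 0] in eventually_elim, auto simp: norm_mult norm_powr_real_powr)
qed

text \<open>Integrate the derivative of \<open>t powr s * exp (-t)\<close> over the tail: the
  boundary value at infinity vanishes and the one at \<open>\<xi>\<close> remains.\<close>

lemma upper_gamma_rec:
  assumes "0 < \<xi>"
  shows "upper_gamma (s + 1) \<xi> = s * upper_gamma s \<xi> + complex_of_real \<xi> powr s * exp (- complex_of_real \<xi>)"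
proof -
  let ?f = "\<lambda>a t. complex_of_real t powr a * exp (- complex_of_real t)"
  let ?g = "\<lambda>t. s * ?f (s - 1) t - ?f s t"
  have int: "set_integrable lborel {\<xi>..} ?g"
    by (intro set_integral_diff set_integrable_mult_right set_integrable_powr_exp assms)
  have ein: "einterval (ereal \<xi>) \<infinity> = {\<xi><..}" by (auto simp: einterval_def)
  have "(LBINT t=ereal \<xi>..\<infinity>. ?g t) = 0 - ?f s \<xi>"
  proof (rule interval_integral_FTC_integrable)
    fix t assume "ereal \<xi> < ereal t" 
    then have t: "t > 0" using assms by simp
    have e: "((\<lambda>t. exp (- complex_of_real t)) has_vector_derivative - exp (- complex_of_real t)) (at t)"
      by (auto intro!: has_vector_derivative_real_field derivative_eq_intros)
    show "(?f s has_vector_derivative ?g t) (at t)"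
      using has_vector_derivative_mult[OF has_vector_derivative_powr_of_real[OF t, of s] e]
      by (simp add: algebra_simps)
    show "isCont ?g t" using t
      by (auto intro!: continuous_intros)
  next
    show "set_integrable lborel (einterval (ereal \<xi>) \<infinity>) ?g"
      by (rule set_integrable_subset[OF int]) (auto simp: ein)
    have "isCont (?f s) \<xi>"
      using assms by (auto intro!: continuous_intros)
    then have "(?f s \<longlongrightarrow> ?f s \<xi>) (at_right \<xi>)"
      by (simp add: isCont_def filterlim_at_split)
    then show "((?f s \<circ> real_of_ereal) \<longlongrightarrow> ?f s \<xi>) (at_right (ereal \<xi>))"
      by (simp add: ereal_tendsto_simps)
    show "((?f s \<circ> real_of_ereal) \<longlongrightarrow> 0) (at_left \<infinity>)"
      using tendsto_powr_exp_at_top by (simp add: ereal_tendsto_simps)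
  qed simp
  \<comment> \<open>The interval integral omits the end point \<open>\<xi>\<close>, which is a null
    set.\<close>
  moreover have "(LBINT t=ereal \<xi>..\<infinity>. ?g t) = (LINT t:{\<xi>..}|lborel. ?g t)"
  proof -
    have "(LINT t:{\<xi><..}|lborel. ?g t) = (LINT t:{\<xi>..}|lborel. ?g t)"
      unfolding set_lebesgue_integral_def
    proof (rule integral_cong_AE)
      show "AE t in lborel. indicat_real {\<xi><..} t *\<^sub>R ?g t = indicat_real {\<xi>..} t *\<^sub>R ?g t"
        using AE_lborel_singleton[of \<xi>] by eventually_elim (auto simp: indicator_def)
      show "(\<lambda>t. indicat_real {\<xi>..} t *\<^sub>R ?g t) \<in> borel_measurable lborel"
        using int unfolding set_integrable_def by (rule borel_measurable_integrable)
      have "set_integrable lborel {\<xi><..} ?g"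
        by (rule set_integrable_subset[OF int]) auto
      then show "(\<lambda>t. indicat_real {\<xi><..} t *\<^sub>R ?g t) \<in> borel_measurable lborel"
        unfolding set_integrable_def by (rule borel_measurable_integrable)
    qed
    then show ?thesis by (simp add: interval_lebesgue_integral_def ein)
  qed
  moreover have "(LINT t:{\<xi>..}|lborel. ?g t) = s * upper_gamma s \<xi> - upper_gamma (s + 1) \<xi>"
    unfolding upper_gamma_def
    by (subst set_integral_diff)
       (auto intro!: set_integrable_mult_right set_integrable_powr_exp assms)
  ultimately have "0 - ?f s \<xi> = s * upper_gamma s \<xi> - upper_gamma (s + 1) \<xi>"
    by (simp only:)
  then show ?thesis by (simp add: diff_eq_eq eq_diff_eq)
qed

section \<open>The Gamma function as a Taylor part plus a tail\<close>

lemma Gamma_split_pos: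
  assumes s: "Re s > 0" and \<xi>: "0 < \<xi>"
  shows "complex_of_real \<xi> powr s * gamma_series s (complex_of_real \<xi>) + upper_gamma s \<xi> = Gamma s"
proof -
  have nonpos: "s \<notin> \<int>\<^sub>\<le>\<^sub>0" using s by (auto elim!: nonpos_Ints_cases)
  let ?f = "\<lambda>t. complex_of_real t powr (s - 1) * exp (- complex_of_real t)"
  let ?G = "\<lambda>t. complex_of_real t powr s * gamma_series s (complex_of_real t)"
  have feq: "(\<lambda>t. of_real t powr (s - 1) / of_real (exp t)) = ?f"
    by (auto simp: exp_minus divide_simps exp_of_real)
  \<comment> \<open>By the differential equation of \<open>gamma_series\<close>, \<open>?G\<close>
    is an antiderivative of \<open>?f\<close> on the open interval. As \<open>Re s > 0\<close>, it
    is continuous up to 0, where its value is 0.\<close>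
  have "(?f has_integral (?G \<xi> - ?G 0)) {0..\<xi>}"
  proof (rule fundamental_theorem_of_calculus_interior)
    have c: "continuous_on UNIV (gamma_series s)"
      by (metis DERIV_isCont continuous_at_imp_continuous_on gamma_series_deriv)
    show "continuous_on {0..\<xi>} ?G"
      using s by (intro continuous_intros continuous_on_compose2[OF c]) auto
    fix t assume "t \<in> {0<..<\<xi>}"
    then have t: "t > 0" by simp
    obtain d where d: "(gamma_series s has_field_derivative d) (at (of_real t))"
      and e: "of_real t * d + s * gamma_series s (of_real t) = exp (- of_real t)"
      using gamma_series_deriv[of s "of_real t"] nonpos by metis
    have "((\<lambda>t. gamma_series s (of_real t)) has_vector_derivative d) (at t)"
      using d by (rule has_vector_derivative_real_field)
    from has_vector_derivative_mult[OF has_vector_derivative_powr_of_real[OF t, of s] this]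
    have "(?G has_vector_derivative of_real t powr s * d + s * of_real t powr (s - 1) * gamma_series s (of_real t)) (at t)"
      by simp
    moreover have "of_real t powr s = of_real t powr (s - 1) * complex_of_real t"
      using t by (simp add: powr_diff)
    then have "of_real t powr s * d + s * of_real t powr (s - 1) * gamma_series s (of_real t) = ?f t"
      unfolding e[symmetric] by (simp add: algebra_simps)
    ultimately show "(?G has_vector_derivative ?f t) (at t)" by simp
  qed (use \<xi> in auto)
  moreover have "(?f has_integral upper_gamma s \<xi>) {\<xi>..}"
    unfolding upper_gamma_def
    using set_borel_integral_eq_integral[OF set_integrable_powr_exp[OF \<xi>, of "s - 1"]] by (simp add: has_integral_integral)
  ultimately have "(?f has_integral (?G \<xi> - ?G 0 + upper_gamma s \<xi>)) ({0..\<xi>} \<union> {\<xi>..})"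
    by (rule has_integral_Un) (auto intro: negligible_subset[of "{\<xi>}"])
  moreover have "{0..\<xi>} \<union> {\<xi>..} = {0..}" using \<xi> by auto
  ultimately show ?thesis
    using has_integral_unique[OF _ Gamma_integral_complex[OF s]] unfolding feq by simp
qed

text \<open>Descend from \<open>s + 1\<close> to \<open>s\<close>: the recurrences of the two parts
  carry the boundary term \<open>\<xi> powr s * exp (-\<xi>)\<close> with opposite signs, so the sum
  obeys the functional equation of Gamma, and \<open>s\<close> can be divided out.\<close>

lemma Gamma_split:
  assumes "s \<notin> \<int>\<^sub>\<le>\<^sub>0" and \<xi>: "0 < \<xi>"
  shows "complex_of_real \<xi> powr s * gamma_series s (complex_of_real \<xi>) + upper_gamma s \<xi> = Gamma s"
  using assms(1)
\<comment> \<open>This measure is 0 exactly when \<open>Re s > 0\<close>; otherwise passing to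
  \<open>s + 1\<close> lowers it by one.\<close>
proof (induction "nat \<lfloor>1 - Re s\<rfloor>" arbitrary: s)
  case 0
  then show ?case by (intro Gamma_split_pos \<xi>) linarith
next
  case (Suc n)
  show ?case
  proof (cases "Re s > 0")
    case True
    then show ?thesis by (intro Gamma_split_pos \<xi>)
  next
    case False
    have s0: "s \<noteq> 0" using Suc.prems by auto
    have "s + 1 \<notin> \<int>\<^sub>\<le>\<^sub>0" using Suc.prems plus_one_in_nonpos_Ints_imp by blast
    moreover have "n = nat \<lfloor>1 - Re (s + 1)\<rfloor>" using Suc.hyps(2) by (simp add: algebra_simps) linarith
    ultimately have IH: "complex_of_real \<xi> powr (s + 1) * gamma_series (s + 1) (complex_of_real \<xi>) + upper_gamma (s + 1) \<xi> = Gamma (s + 1)"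
      by (rule Suc.hyps(1)[rotated])
    have "s * (of_real \<xi> powr s * gamma_series s (of_real \<xi>) + upper_gamma s \<xi>)
      = of_real \<xi> powr s * (s * gamma_series s (of_real \<xi>)) + s * upper_gamma s \<xi>"
      by (simp add: algebra_simps)
    also have "\<dots> = Gamma (s + 1)"
      unfolding gamma_series_rec[OF Suc.prems] IH[symmetric] upper_gamma_rec[OF \<xi>]
      using \<xi> by (simp add: powr_add algebra_simps)
    also have "\<dots> = s * Gamma s" by (rule Gamma_plus1) fact
    finally show ?thesis using s0 by simp
  qed
qed

section \<open>The linear functional on polynomials with moments
  \<open>Gamma (s + i)\<close>\<close>

definition gamma_functional :: "complex \<Rightarrow> complex poly \<Rightarrow> complex" where
  "gamma_functional s p = (\<Sum>i\<le>degree p. coeff p i * Gamma (s + of_nat i))"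

lemma gamma_functional_altdef:
  assumes "degree p \<le> N"
  shows "gamma_functional s p = (\<Sum>i\<le>N. coeff p i * Gamma (s + of_nat i))"
  unfolding gamma_functional_def
  by (rule sum.mono_neutral_left) (use assms in \<open>auto simp: coeff_eq_0 not_le\<close>)

lemma gamma_functional_0 [simp]: "gamma_functional s 0 = 0"
  by (simp add: gamma_functional_def)

text \<open>A factor \<open>x\<close> of the polynomial is absorbed by the weight as a shift of
  \<open>s\<close>. Hence the inductions on polynomials below leave \<open>s\<close>
  arbitrary.\<close>

lemma gamma_functional_pCons:
  "gamma_functional s (pCons c p) = c * Gamma s + gamma_functional (s + 1) p"
proof -
  have "gamma_functional s (pCons c p)
      = (\<Sum>i\<le>Suc (degree p). coeff (pCons c p) i * Gamma (s + of_nat i))"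
    by (rule gamma_functional_altdef) (rule degree_pCons_le)
  then show ?thesis
    by (simp add: sum.atMost_Suc_shift gamma_functional_def add_ac del: sum.atMost_Suc)
qed

lemma gamma_functional_add:
  "gamma_functional s (p + q) = gamma_functional s p + gamma_functional s q"
proof -
  let ?N = "max (degree p) (degree q)"
  have "degree (p + q) \<le> ?N" by (rule degree_add_le_max)
  from gamma_functional_altdef[OF this, of s] show ?thesis
    by (simp add: gamma_functional_altdef[of p ?N] gamma_functional_altdef[of q ?N]
        sum.distrib algebra_simps)
qed

lemma gamma_functional_smult: "gamma_functional s (smult c p) = c * gamma_functional s p"
  using gamma_functional_altdef[OF degree_smult_le, of s c p]
  by (simp add: gamma_functional_def sum_distrib_left mult.assoc)

section \<open>The finite part of a polynomial times the exponential\<close>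

lemma plus_1_notin_nonpos_Ints: "s \<notin> \<int>\<^sub>\<le>\<^sub>0 \<Longrightarrow> s + 1 \<notin> (\<int>\<^sub>\<le>\<^sub>0 :: complex set)"
  using plus_one_in_nonpos_Ints_imp by blast

lemma powr_mult_of_real_plus_1:
  "complex_of_real t powr (s + 1) = complex_of_real t powr s * complex_of_real t"
  by (cases "t = 0") (simp_all add: powr_add)

lemma set_integrable_powr_exp_poly:
  assumes "0 < \<xi>"
  shows "set_integrable lborel {\<xi>..}
    (\<lambda>t. complex_of_real t powr a * (exp (- complex_of_real t) * poly p (complex_of_real t)))"
proof (induction p arbitrary: a)
  case 0
  then show ?case by (simp add: set_integrable_def)
next
  case (pCons c p)
  have "set_integrable lborel {\<xi>..} (\<lambda>t. c * (complex_of_real t powr a * exp (- complex_of_real t))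
     + complex_of_real t powr (a + 1) * (exp (- complex_of_real t) * poly p (complex_of_real t)))"
    by (intro set_integral_add set_integrable_mult_right set_integrable_powr_exp pCons.IH assms)
  then show ?case by (simp add: powr_mult_of_real_plus_1 distrib_left mult_ac)
qed

text \<open>With \<open>s = \<alpha> + 1\<close> this evaluates the Taylor part in the finite part
  integral. In \<open>pCons c p\<close> the constant \<open>c\<close> is handled by
  \<open>Gamma_split\<close> at \<open>s\<close>, and \<open>x * p\<close> by the induction
  hypothesis at \<open>s + 1\<close>.\<close>

lemma exp_poly_fps_sums:
  assumes "s \<notin> \<int>\<^sub>\<le>\<^sub>0" and \<xi>: "0 < \<xi>"
  shows "(\<lambda>m. fps_nth (fps_exp (-1) * fps_of_poly p) m / (of_nat m + s)
            * complex_of_real \<xi> powr (of_nat m + s)) sums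
         (gamma_functional s p - (LINT t:{\<xi>..}|lborel. complex_of_real t powr (s - 1)
            * (exp (- complex_of_real t) * poly p (complex_of_real t))))"
  using assms(1)
proof (induction p arbitrary: s)
  case 0
  then show ?case by simp
next
  case (pCons c p)
  let ?E = "fps_exp (-1 :: complex)"
  let ?tail = "\<lambda>s p. LINT t:{\<xi>..}|lborel. complex_of_real t powr (s - 1)
            * (exp (- complex_of_real t) * poly p (complex_of_real t))"
  let ?a = "\<lambda>s p m. fps_nth (?E * fps_of_poly p) m / (of_nat m + s)
            * complex_of_real \<xi> powr (of_nat m + s)"
  \<comment> \<open>The contribution of \<open>x * p\<close>: raising the index and raising
    \<open>s\<close> by one have the same effect on \<open>of_nat m + s\<close>, so the terms for
    \<open>s + 1\<close> are reused one place later.\<close>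
  let ?u = "\<lambda>m. case m of 0 \<Rightarrow> 0 | Suc k \<Rightarrow> ?a (s + 1) p k"
  have "(\<lambda>m. ?u (Suc m)) sums (gamma_functional (s + 1) p - ?tail (s + 1) p)"
    using pCons.IH[OF plus_1_notin_nonpos_Ints[OF pCons.prems]] by simp
  from sums_Suc[OF this] have u: "?u sums (gamma_functional (s + 1) p - ?tail (s + 1) p)"
    by simp
  let ?v = "\<lambda>m. c * (complex_of_real \<xi> powr s * (gamma_coeff s m * complex_of_real \<xi> ^ m))"
  have "?v sums (c * (complex_of_real \<xi> powr s * gamma_series s (complex_of_real \<xi>)))"
    by (intro sums_mult gamma_series_sums)
  also have "complex_of_real \<xi> powr s * gamma_series s (complex_of_real \<xi>) = Gamma s - upper_gamma s \<xi>"
    using Gamma_split[OF pCons.prems \<xi>] by (simp add: algebra_simps)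
  finally have v: "?v sums (c * (Gamma s - upper_gamma s \<xi>))" .
  have "?v m + ?u m = ?a s (pCons c p) m" for m
  proof -
    have nth: "fps_nth (?E * fps_of_poly (pCons c p)) m
        = c * ((-1) ^ m / fact m) + (case m of 0 \<Rightarrow> 0 | Suc k \<Rightarrow> fps_nth (?E * fps_of_poly p) k)"
      by (simp add: fps_of_poly_pCons distrib_left mult.assoc[symmetric] mult.commute[of _ "fps_const c"]
          split: nat.split)
    have "?v m = c * ((-1) ^ m / fact m) / (of_nat m + s) * complex_of_real \<xi> powr (of_nat m + s)"
      using \<xi> by (simp add: gamma_coeff_def powr_add powr_nat)
    moreover have "?u m = (case m of 0 \<Rightarrow> 0 | Suc k \<Rightarrow> fps_nth (?E * fps_of_poly p) k)
        / (of_nat m + s) * complex_of_real \<xi> powr (of_nat m + s)"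
      by (cases m) (simp_all add: add_ac)
    ultimately show ?thesis
      by (simp only: nth add_divide_distrib distrib_right)
  qed
  moreover have "?tail s (pCons c p) = c * upper_gamma s \<xi> + ?tail (s + 1) p"
  proof -
    have "complex_of_real t powr (s - 1) * (exp (- complex_of_real t) * poly (pCons c p) (complex_of_real t))
        = c * (complex_of_real t powr (s - 1) * exp (- complex_of_real t))
        + complex_of_real t powr (s + 1 - 1) * (exp (- complex_of_real t) * poly p (complex_of_real t))" for t
      using powr_mult_of_real_plus_1[of t "s - 1"] by (simp add: distrib_left mult_ac)
    then have "?tail s (pCons c p) = (LINT t:{\<xi>..}|lborel.
        c * (complex_of_real t powr (s - 1) * exp (- complex_of_real t))
        + complex_of_real t powr (s + 1 - 1) * (exp (- complex_of_real t) * poly p (complex_of_real t)))"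
      by (simp only:)
    also have "\<dots> = (LINT t:{\<xi>..}|lborel. c * (complex_of_real t powr (s - 1) * exp (- complex_of_real t)))
        + ?tail (s + 1) p"
      by (intro set_integral_add set_integrable_mult_right set_integrable_powr_exp
          set_integrable_powr_exp_poly \<xi>)
    also have "\<dots> = c * upper_gamma s \<xi> + ?tail (s + 1) p"
      by (simp add: upper_gamma_def)
    finally show ?thesis .
  qed
  ultimately show ?case
    using sums_add[OF v u] by (simp add: gamma_functional_pCons algebra_simps)
qed

lemma plus_1_notin_nonpos_Ints_iff:
  "\<alpha> + 1 \<notin> \<int>\<^sub>\<le>\<^sub>0 \<longleftrightarrow> \<alpha> \<notin> {- of_nat m | m :: nat. m \<ge> 1}" for \<alpha> :: complex
proof -
  have "\<alpha> + 1 \<in> \<int>\<^sub>\<le>\<^sub>0 \<longleftrightarrow> (\<exists>n::nat. \<alpha> = - of_nat (Suc n))"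
    by (auto elim!: nonpos_Ints_cases' simp: eq_diff_eq[symmetric])
  also have "\<dots> \<longleftrightarrow> (\<exists>m::nat. \<alpha> = - of_nat m \<and> m \<ge> 1)"
    by (metis One_nat_def Suc_le_D le_add1 plus_1_eq_Suc)
  finally show ?thesis by auto
qed

lemma has_fp_integral_exp_poly:
  assumes "\<alpha> \<notin> {- of_nat m | m :: nat. m \<ge> 1}"
  shows "has_fp_integral \<alpha> (\<lambda>x. exp (- x) * poly p x) (gamma_functional (\<alpha> + 1) p)"
proof -
  have s: "\<alpha> + 1 \<notin> \<int>\<^sub>\<le>\<^sub>0" using assms by (simp only: plus_1_notin_nonpos_Ints_iff) simp
  have "poly p has_fps_expansion fps_of_poly p"
    by (simp add: has_fps_expansion_def)
  then have "(\<lambda>x. exp (-1 * x) * poly p x) has_fps_expansion (fps_exp (-1) * fps_of_poly p)"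
    by (intro fps_expansion_intros)
  then have "fps_expansion (\<lambda>x. exp (- x) * poly p x) 0 = fps_exp (-1) * fps_of_poly p"
    by (intro fps_expansion_eqI) simp
  moreover have "\<exists>a>0. set_integrable lborel {a..} (\<lambda>t. complex_of_real t powr \<alpha> *
      (exp (- complex_of_real t) * poly p (complex_of_real t)))"
    by (rule exI[of _ 1]) (simp add: set_integrable_powr_exp_poly)
  moreover have "(\<lambda>x. exp (- x) * poly p x) analytic_on complex_of_real ` {0..}"
    by (rule analytic_on_subset[of _ UNIV]) (auto simp: analytic_on_open intro!: holomorphic_intros)
  \<comment> \<open>This holds at every positive \<open>\<xi>\<close>, in particular at every
    admissible one.\<close>
  moreover have "gamma_functional (\<alpha> + 1) p =
      (\<Sum>m. fps_nth (fps_exp (-1) * fps_of_poly p) m / (of_nat m + \<alpha> + 1)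
         * complex_of_real \<xi> powr (of_nat m + \<alpha> + 1))
      + (LINT t:{\<xi>..}|lborel. complex_of_real t powr \<alpha> * (exp (- complex_of_real t) * poly p (complex_of_real t)))"
    if "0 < \<xi>" for \<xi>
    using sums_unique[OF exp_poly_fps_sums[OF s that, of p]]
    by (simp add: add.assoc diff_eq_eq)
  ultimately show ?thesis
    unfolding has_fp_integral_def using assms by simp
qed

text \<open>Analyticity at 0 gives a positive radius of convergence, so some admissible
  \<open>\<xi>\<close> exists, and its formula fixes the value. This justifies the
  \<open>THE\<close> in \<open>fp_integral\<close>.\<close>

lemma has_fp_integral_unique:
  assumes "has_fp_integral \<alpha> F I" "has_fp_integral \<alpha> F J"
  shows "I = J"
proof -
  have "F analytic_on {0}"
    using assms(1) unfolding has_fp_integral_def by (auto elim: analytic_on_subset)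
  then have "fps_conv_radius (fps_expansion F 0) > 0"
    by (meson analytic_at_imp_has_fps_expansion_0 has_fps_expansion_def)
  then obtain \<xi> where "0 < ereal \<xi>" "ereal \<xi> < fps_conv_radius (fps_expansion F 0)"
    using ereal_dense2 by blast
  then have "H = (\<Sum>m. fps_nth (fps_expansion F 0) m / (of_nat m + \<alpha> + 1)
        * complex_of_real \<xi> powr (of_nat m + \<alpha> + 1))
      + (LINT t:{\<xi>..}|lborel. complex_of_real t powr \<alpha> * F (complex_of_real t))"
    if "has_fp_integral \<alpha> F H" for H
    using that unfolding has_fp_integral_def by simp
  from this[OF assms(1)] this[OF assms(2)] show ?thesis by (simp only:)
qed

lemma laguerre_form_eq:
  assumes "\<alpha> \<notin> {- of_nat m | m :: nat. m \<ge> 1}"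
  shows "laguerre_form \<alpha> f g = gamma_functional (\<alpha> + 1) (f * g)"
proof -
  have "has_fp_integral \<alpha> (\<lambda>x. exp (- x) * poly f x * poly g x) (gamma_functional (\<alpha> + 1) (f * g))"
    using has_fp_integral_exp_poly[OF assms, of "f * g"] by (simp only: poly_mult mult.assoc)
  then show ?thesis
    unfolding laguerre_form_def fp_integral_def
    by (intro the_equality) (assumption | rule has_fp_integral_unique, assumption+)+
qed

section \<open>The Rodrigues formula in polynomial form\<close>

fun rodrigues :: "complex \<Rightarrow> nat \<Rightarrow> complex poly" where
  "rodrigues a 0 = 1"
| "rodrigues a (Suc j) = pCons 0 (pderiv (rodrigues a j)) + [:a - of_nat j, -1:] * rodrigues a j"

text \<open>With \<open>a = \<alpha> + n\<close>, differentiating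
  \<open>x powr (a - j) * exp (-x) * q\<close> gives \<open>x powr (a - j - 1) * exp (-x)\<close>
  times \<open>x * q' + (a - j - x) * q\<close>, which is the recursion of
  \<open>rodrigues\<close>.\<close>

lemma higher_vector_derivative_weight:
  fixes x :: real
  assumes "0 < x"
  shows "((\<lambda>f y. vector_derivative f (at y)) ^^ j) (\<lambda>y. complex_of_real y ^ n * laguerre_weight \<alpha> y) x
    = complex_of_real x powr (\<alpha> + of_nat n - of_nat j) * exp (- complex_of_real x)
      * poly (rodrigues (\<alpha> + of_nat n) j) (complex_of_real x)"
  using assms
proof (induction j arbitrary: x)
  case 0
  then show ?case by (simp add: laguerre_weight_def powr_add powr_nat)
next
  case (Suc j)
  let ?b = "\<alpha> + of_nat n - of_nat j"
  let ?q = "rodrigues (\<alpha> + of_nat n) j"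
  let ?g = "\<lambda>y. complex_of_real y powr ?b * (exp (- complex_of_real y) * poly ?q (complex_of_real y))"
  let ?D = "complex_of_real x powr (?b - 1) * exp (- complex_of_real x)
      * poly (rodrigues (\<alpha> + of_nat n) (Suc j)) (complex_of_real x)"
  have "((\<lambda>y. exp (- complex_of_real y) * poly ?q (complex_of_real y)) has_vector_derivative
      (exp (- complex_of_real x) * (poly (pderiv ?q) (complex_of_real x) - poly ?q (complex_of_real x)))) (at x)"
    by (rule has_vector_derivative_real_field)
       (auto intro!: derivative_eq_intros poly_DERIV simp: algebra_simps)
  from has_vector_derivative_mult[OF has_vector_derivative_powr_of_real[OF Suc.prems, of ?b] this]
  have "(?g has_vector_derivative (complex_of_real x powr ?b * (exp (- complex_of_real x) *
       (poly (pderiv ?q) (complex_of_real x) - poly ?q (complex_of_real x)))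
     + ?b * complex_of_real x powr (?b - 1) * (exp (- complex_of_real x) * poly ?q (complex_of_real x)))) (at x)" .
  also have "(complex_of_real x powr ?b * (exp (- complex_of_real x) *
       (poly (pderiv ?q) (complex_of_real x) - poly ?q (complex_of_real x)))
     + ?b * complex_of_real x powr (?b - 1) * (exp (- complex_of_real x) * poly ?q (complex_of_real x))) = ?D"
    using powr_mult_of_real_plus_1[of x "?b - 1"] by (simp add: algebra_simps)
  \<comment> \<open>The induction hypothesis describes the iterated derivative on the positive half
    line only; this set is open, so the derivative at \<open>x\<close> can be computed
    there.\<close>
  finally have "(((\<lambda>f y. vector_derivative f (at y)) ^^ j)
      (\<lambda>y. complex_of_real y ^ n * laguerre_weight \<alpha> y) has_vector_derivative ?D) (at x)"
    by (rule has_vector_derivative_transform_within_open[where S = "{0<..}"])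
       (use Suc in \<open>auto simp: mult.assoc\<close>)
  from vector_derivative_at[OF this] show ?case
    by (simp add: diff_diff_eq[symmetric] add.commute[of 1] del: rodrigues.simps)
qed

text \<open>A nonzero polynomial has finitely many roots. This gives the uniqueness behind the
  \<open>THE\<close> in \<open>laguerre\<close>.\<close>

lemma poly_eqI_positive_reals:
  fixes p q :: "complex poly"
  assumes "\<And>x::real. 0 < x \<Longrightarrow> poly p (of_real x) = poly q (of_real x)"
  shows "p = q"
proof (rule ccontr)
  assume "p \<noteq> q"
  then have "finite {z. poly (p - q) z = 0}" by (intro poly_roots_finite) simp
  then have "finite (complex_of_real ` {0<..})"
    by (rule finite_subset[rotated]) (use assms in auto)
  then have "finite {0::real<..}" by (simp add: finite_image_iff inj_on_def)
  then show False using infinite_Ioi by blast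
qed

text \<open>At \<open>j = n\<close> the exponent has come back to \<open>\<alpha>\<close>, so the
  weight cancels.\<close>

lemma laguerre_eq_rodrigues: "laguerre \<alpha> n = rodrigues (\<alpha> + of_nat n) n"
proof -
  have "inverse (laguerre_weight \<alpha> x) * ((\<lambda>f y. vector_derivative f (at y)) ^^ n)
         (\<lambda>y. complex_of_real y ^ n * laguerre_weight \<alpha> y) x
       = poly (rodrigues (\<alpha> + of_nat n) n) (complex_of_real x)" if "x > 0" for x
    using that unfolding higher_vector_derivative_weight[OF that] by (simp add: laguerre_weight_def field_simps)
  then show ?thesis
    unfolding laguerre_def by (intro the_equality) (auto intro!: poly_eqI_positive_reals)
qed

section \<open>Integration by parts for the functional\<close>

lemma gamma_functional_mult_linear:
  "gamma_functional s ([:a, -1:] * p) = a * gamma_functional s p - gamma_functional (s + 1) p"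
proof -
  have "[:a, -1:] * p = smult a p + smult (-1) (pCons 0 p)" by simp
  then show ?thesis
    by (simp only: gamma_functional_add gamma_functional_smult gamma_functional_pCons) simp
qed

text \<open>The algebraic form of \<open>\<integral> (x\<^sup>s exp (-x) p(x))' dx = 0\<close>.\<close>

lemma gamma_functional_pderiv:
  assumes "s \<notin> \<int>\<^sub>\<le>\<^sub>0"
  shows "gamma_functional (s + 1) (pderiv p) + gamma_functional s ([:s, -1:] * p) = 0"
  using assms
proof (induction p arbitrary: s)
  case 0
  then show ?case by simp
next
  case (pCons c p)
  from pCons.IH[OF plus_1_notin_nonpos_Ints[OF pCons.prems]]
  have IH: "gamma_functional (s + 2) (pderiv p) + ((s + 1) * gamma_functional (s + 1) p
      - gamma_functional (s + 2) p) = 0"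
    by (simp only: gamma_functional_mult_linear) (simp add: add.assoc)
  \<comment> \<open>The functional equation of Gamma makes the two terms with \<open>c\<close>
    cancel; what is left, added to the derivative term, is the induction hypothesis at
    \<open>s + 1\<close>.\<close>
  have linear: "gamma_functional s ([:s, -1:] * pCons c p)
      = s * (c * Gamma s + gamma_functional (s + 1) p)
        - (c * (s * Gamma s) + gamma_functional (s + 2) p)"
    by (simp only: gamma_functional_mult_linear gamma_functional_pCons Gamma_plus1[OF pCons.prems])
       (simp add: add.assoc)
  have deriv: "gamma_functional (s + 1) (pderiv (pCons c p))
      = gamma_functional (s + 1) p + gamma_functional (s + 2) (pderiv p)"
    by (simp add: pderiv_pCons gamma_functional_add gamma_functional_pCons add.assoc)
  from IH show ?case by (simp only: linear deriv) (simp add: algebra_simps)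
qed

text \<open>With \<open>b = a - j\<close> and \<open>q = rodrigues a j\<close>, the product is
  \<open>x * q' * f + (b - x) * q * f\<close>. Integration by parts for \<open>q * f\<close>
  annihilates \<open>x * (q * f)' + (b - x) * q * f\<close>, and the difference is
  \<open>- x * q * f'\<close>.\<close>

lemma gamma_functional_rodrigues_Suc:
  assumes "a - of_nat j \<notin> \<int>\<^sub>\<le>\<^sub>0"
  shows "gamma_functional (a - of_nat j) (rodrigues a (Suc j) * f)
       = - gamma_functional (a - of_nat j + 1) (rodrigues a j * pderiv f)"
proof -
  let ?b = "a - of_nat j" and ?q = "rodrigues a j"
  have "rodrigues a (Suc j) * f = pCons 0 (pderiv ?q * f) + [:?b, -1:] * (?q * f)"
    by (simp only: rodrigues.simps distrib_right mult.assoc) simp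
  then have "gamma_functional ?b (rodrigues a (Suc j) * f)
      = gamma_functional (?b + 1) (pderiv ?q * f) + gamma_functional ?b ([:?b, -1:] * (?q * f))"
    by (simp only: gamma_functional_add gamma_functional_pCons) simp
  moreover have "pderiv (?q * f) = ?q * pderiv f + pderiv ?q * f"
    by (simp add: pderiv_mult mult.commute)
  then have "gamma_functional (?b + 1) (?q * pderiv f) + gamma_functional (?b + 1) (pderiv ?q * f)
      + gamma_functional ?b ([:?b, -1:] * (?q * f)) = 0"
    using gamma_functional_pderiv[OF assms, of "?q * f"] by (simp only: gamma_functional_add)
  ultimately show ?thesis by (simp only: eq_neg_iff_add_eq_0 add.commute add.left_commute)
qed

lemma gamma_functional_rodrigues:
  assumes "\<alpha> + 1 \<notin> \<int>\<^sub>\<le>\<^sub>0" "j \<le> n"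
  shows "gamma_functional (\<alpha> + of_nat n + 1 - of_nat j) (rodrigues (\<alpha> + of_nat n) j * f)
       = (-1) ^ j * gamma_functional (\<alpha> + of_nat n + 1) ((pderiv ^^ j) f)"
  using assms(2)
proof (induction j arbitrary: f)
  case 0
  then show ?case by simp
next
  case (Suc j)
  let ?a = "\<alpha> + of_nat n"
  \<comment> \<open>Since \<open>Suc j \<le> n\<close>, the parameter is \<open>\<alpha> + 1\<close>
    plus a natural number and so avoids the poles of Gamma.\<close>
  have "of_nat (n - Suc j) + (\<alpha> + 1) = ?a - of_nat j"
    using Suc.prems by (simp add: of_nat_diff)
  moreover have "of_nat (n - Suc j) + (\<alpha> + 1) \<notin> \<int>\<^sub>\<le>\<^sub>0"
  proof
    assume "of_nat (n - Suc j) + (\<alpha> + 1) \<in> \<int>\<^sub>\<le>\<^sub>0"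
    then obtain k where "of_nat (n - Suc j) + (\<alpha> + 1) = - of_nat k"
      by (auto elim: nonpos_Ints_cases')
    then have "of_nat (k + (n - Suc j)) + (\<alpha> + 1) = 0"
      by (simp only: of_nat_add add.assoc) simp
    with of_nat_add_nonzero[OF assms(1)] show False by blast
  qed
  ultimately have nonpos: "?a - of_nat j \<notin> \<int>\<^sub>\<le>\<^sub>0" by metis
  have "?a + 1 - of_nat (Suc j) = ?a - of_nat j" by simp
  then have "gamma_functional (?a + 1 - of_nat (Suc j)) (rodrigues ?a (Suc j) * f)
      = - gamma_functional (?a - of_nat j + 1) (rodrigues ?a j * pderiv f)"
    by (simp only: gamma_functional_rodrigues_Suc[OF nonpos])
  also have "?a - of_nat j + 1 = ?a + 1 - of_nat j" by simp
  also have "gamma_functional (?a + 1 - of_nat j) (rodrigues ?a j * pderiv f)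
      = (-1) ^ j * gamma_functional (?a + 1) ((pderiv ^^ j) (pderiv f))"
    using Suc by (intro Suc.IH) simp
  finally show ?case by (simp add: funpow_swap1)
qed

section \<open>Leading coefficients, orthogonality and the norm\<close>

lemma degree_rodrigues_le: "degree (rodrigues a j) \<le> j"
proof (induction j)
  case 0
  then show ?case by simp
next
  case (Suc j)
  have "degree (pCons 0 (pderiv (rodrigues a j))) \<le> Suc j"
    using Suc degree_pderiv[of "rodrigues a j"] degree_pCons_le[of 0 "pderiv (rodrigues a j)"] by linarith
  moreover have "degree ([:a - of_nat j, -1:] * rodrigues a j) \<le> Suc j"
    using Suc degree_mult_le[of "[:a - of_nat j, -1:]" "rodrigues a j"] by simp
  ultimately show ?case by (simp only: rodrigues.simps degree_add_le)
qed

lemma coeff_rodrigues: "coeff (rodrigues a j) j = (-1) ^ j"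
proof (induction j)
  case 0
  then show ?case by simp
next
  case (Suc j)
  \<comment> \<open>Thus only the \<open>-x\<close> of the linear factor reaches degree
    \<open>Suc j\<close>, and each step flips the sign of the leading coefficient.\<close>
  have "coeff (rodrigues a j) (Suc j) = 0"
    using degree_rodrigues_le[of a j] by (intro coeff_eq_0) simp
  then show ?case by (simp add: coeff_pderiv Suc.IH)
qed

text \<open>At \<open>j = n\<close> the parameter on the left is \<open>\<alpha> + 1\<close>, that
  of the form, and all \<open>n\<close> derivatives have moved to \<open>f\<close>.\<close>

lemma laguerre_form_laguerre_left:
  assumes "\<alpha> \<notin> {- of_nat m | m :: nat. m \<ge> 1}"
  shows "laguerre_form \<alpha> (laguerre \<alpha> n) f
       = (-1) ^ n * gamma_functional (\<alpha> + of_nat n + 1) ((pderiv ^^ n) f)"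
proof -
  have "\<alpha> + 1 \<notin> \<int>\<^sub>\<le>\<^sub>0" using assms by (simp only: plus_1_notin_nonpos_Ints_iff) simp
  from gamma_functional_rodrigues[OF this order_refl, of n f] show ?thesis
    unfolding laguerre_form_eq[OF assms] laguerre_eq_rodrigues by (simp add: algebra_simps)
qed

lemma laguerre_form_laguerre_less:
  assumes "\<alpha> \<notin> {- of_nat m | m :: nat. m \<ge> 1}" and "k < n"
  shows "laguerre_form \<alpha> (laguerre \<alpha> n) (laguerre \<alpha> k) = 0"
proof -
  have "(pderiv ^^ n) (laguerre \<alpha> k) = 0"
    by (rule poly_eqI)
       (use assms(2) degree_rodrigues_le[of "\<alpha> + of_nat k" k] in
         \<open>simp add: coeff_higher_pderiv laguerre_eq_rodrigues coeff_eq_0\<close>)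
  then show ?thesis by (simp add: laguerre_form_laguerre_left[OF assms(1)])
qed

theorem theorem8:
  fixes \<alpha> :: complex and n k :: nat
  assumes "\<alpha> \<notin> {- of_nat m | m :: nat. m \<ge> 1}"
  shows "(k \<noteq> n \<longrightarrow> laguerre_form \<alpha> (laguerre \<alpha> n) (laguerre \<alpha> k) = 0) \<and>
         laguerre_form \<alpha> (laguerre \<alpha> n) (laguerre \<alpha> n) = fact n * Gamma (\<alpha> + of_nat n + 1)"
proof (intro conjI impI)
  assume "k \<noteq> n"
  then consider "k < n" | "n < k" by linarith
  then show "laguerre_form \<alpha> (laguerre \<alpha> n) (laguerre \<alpha> k) = 0"
  proof cases
    case 1
    then show ?thesis by (rule laguerre_form_laguerre_less[OF assms])
  next
    case 2
    \<comment> \<open>The form depends only on the product of its arguments and is therefore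
      symmetric.\<close>
    from laguerre_form_laguerre_less[OF assms this] show ?thesis
      by (simp add: laguerre_form_eq[OF assms] mult.commute)
  qed
next
  \<comment> \<open>Only the leading term survives \<open>n\<close> derivatives; its sign cancels
    the \<open>(-1) ^ n\<close> from the integrations by parts.\<close>
  have "(pderiv ^^ n) (laguerre \<alpha> n) = [:fact n * (-1) ^ n:]"
  proof (rule poly_eqI)
    fix i
    show "coeff ((pderiv ^^ n) (laguerre \<alpha> n)) i = coeff [:fact n * (-1) ^ n:] i"
      using degree_rodrigues_le[of "\<alpha> + of_nat n" n]
      by (cases i) (simp_all add: coeff_higher_pderiv laguerre_eq_rodrigues coeff_rodrigues coeff_eq_0
          pochhammer_fact[symmetric])
  qed
  then show "laguerre_form \<alpha> (laguerre \<alpha> n) (laguerre \<alpha> n) = fact n * Gamma (\<alpha> + of_nat n + 1)"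
    by (simp add: laguerre_form_laguerre_left[OF assms] gamma_functional_pCons flip: power_mult_distrib)
qed

end
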